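(* Let $d\ge 1$, let $\alpha>1$ and let $m\in L^{\alpha,\infty}(\mathbb{T}^d)$. Then $T_m$ is a bounded operator from $\ell^p(\mathbb{Z}^d)$ into $\ell^q(\mathbb{Z}^d)$ whenever $$1<p\le 2\le q<\infty\quad\text{and}\quad \frac1p-\frac1q=\frac1\alpha .$$ That is, for such $p,q$ there is a constant $C>0$ such that $\|T_m f\|_{\ell^q}\le C\|f\|_{\ell^p}$ for all finitely supported $f:\mathbb{Z}^d\to\mathbb{C}$, so that $T_m$ extends uniquely to a bounded operator $\ell^p(\mathbb{Z}^d)\to\ell^q(\mathbb{Z}^d)$.
   Context: $\mathbb{T}^d=\mathbb{R}^d/\mathbb{Z}^d$; functions on $\mathbb{T}^d$ are identified with functions on $\mathbb{R}^d$ that are $1$-periodic in each coordinate, and the Haar measure is Lebesgue measure on $[0,1)^d$. $\ell^p(\mathbb{Z}^d)$ denotes the usual space of $p$-summable complex functions on $\mathbb{Z}^d$ with norm $\|f\|_{\ell^p}=(\sum_n|f(n)|^p)^{1/p}$. Fourier transform: $\mathcal{F}_{\mathbb{Z}^d}(f)(\xi)=\sum_{n\in\mathbb{Z}^d}f(n)e^{2\pi i n\cdot\xi}$, with inverse $\mathcal{F}_{\mathbb{Z}^d}^{-1}(u)(n)=\int_{(0,1)^d}u(\xi)e^{-2\pi i\xi\cdot n}\,d\xi$. For $r>1$, $L^{r,\infty}(\mathbb{T}^d)$ is the space of measurable functions $m$ on $\mathbb{T}^d$ for which there is a constant $c>0$ such that the Lebesgue measure of $\{\xi\in(0,1)^d: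 |m(\xi)|\ge s\}$ is at most $c/s^r$ for all $s>0$. Such an $m$ is integrable on $(0,1)^d$. The multiplier operator $T_m$ is defined by $\mathcal{F}_{\mathbb{Z}^d}(T_m f)=m\,\mathcal{F}_{\mathbb{Z}^d}(f)$, i.e. $T_mf=\mathcal{F}_{\mathbb{Z}^d}^{-1}(m\,\mathcal{F}_{\mathbb{Z}^d}(f))$ for finitely supported $f$. *)

theory Defs
  imports "HOL-Analysis.Analysis"
begin

text \<open>
  The dimension is the cardinality of the finite index type \<open>'d\<close>: the lattice is
  \<open>int ^ 'd\<close>, and functions on the torus are functions on \<open>real ^ 'd\<close> that are 1-periodic
  in each coordinate. Here \<open>box 0 1\<close> is the open unit cube, since \<open>1 :: real ^ 'd\<close> is
  the all-ones vector.
\<close>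

definition lattice_dot :: "int ^ 'd \<Rightarrow> real ^ 'd \<Rightarrow> real" where
  "lattice_dot n \<xi> = (\<Sum>i\<in>UNIV. real_of_int (n $ i) * \<xi> $ i)"

definition lp_space :: "real \<Rightarrow> (int ^ 'd \<Rightarrow> complex) set" where
  "lp_space p = {f. (\<lambda>n. cmod (f n) powr p) summable_on UNIV}"

text \<open>Only meaningful on \<^term>\<open>lp_space p\<close>: a divergent \<open>infsum\<close> is 0.\<close>

definition lp_norm :: "real \<Rightarrow> (int ^ 'd \<Rightarrow> complex) \<Rightarrow> real" where
  "lp_norm p f = (\<Sum>\<^sub>\<infinity>n. cmod (f n) powr p) powr (1 / p)"

definition finitely_supported :: "(int ^ 'd \<Rightarrow> complex) \<Rightarrow> bool" where
  "finitely_supported f \<longleftrightarrow> finite {n. f n \<noteq> 0}"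

definition fourier :: "(int ^ 'd \<Rightarrow> complex) \<Rightarrow> real ^ 'd \<Rightarrow> complex" where
  "fourier f \<xi> = (\<Sum>\<^sub>\<infinity>n. f n * exp (2 * pi * \<i> * lattice_dot n \<xi>))"

definition inv_fourier :: "(real ^ 'd \<Rightarrow> complex) \<Rightarrow> int ^ 'd \<Rightarrow> complex" where
  "inv_fourier u n =
     (LINT \<xi>:box 0 1|lebesgue. u \<xi> * exp (- (2 * pi * \<i> * lattice_dot n \<xi>)))"

definition weak_L_torus :: "real \<Rightarrow> (real ^ 'd \<Rightarrow> complex) set" where
  "weak_L_torus r =
     {m. (\<forall>\<xi> i. m (\<xi> + axis i 1) = m \<xi>) \<and>
         m \<in> borel_measurable lebesgue \<and>
         (\<exists>c>0. \<forall>s>0. emeasure lebesgue {\<xi> \<in> box 0 1. s \<le> cmod (m \<xi>)}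
                       \<le> ennreal (c / s powr r))}"

definition multiplier_op ::
    "(real ^ 'd \<Rightarrow> complex) \<Rightarrow> (int ^ 'd \<Rightarrow> complex) \<Rightarrow> int ^ 'd \<Rightarrow> complex" where
  "multiplier_op m f = inv_fourier (\<lambda>\<xi>. m \<xi> * fourier f \<xi>)"

text \<open>
  Operators are extensional functions on \<^term>\<open>lp_space p\<close>, so that equality of operators is
  equality on \<^term>\<open>lp_space p\<close>.
\<close>

definition bounded_lp_operators ::
    "real \<Rightarrow> real \<Rightarrow> ((int ^ 'd \<Rightarrow> complex) \<Rightarrow> int ^ 'd \<Rightarrow> complex) set" where
  "bounded_lp_operators p q =
     {S \<in> lp_space p \<rightarrow>\<^sub>E lp_space q.
        (\<forall>f\<in>lp_space p. \<forall>g\<in>lp_space p. S (\<lambda>n. f n + g n) = (\<lambda>n. S f n + S g n)) \<and>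
        (\<forall>c. \<forall>f\<in>lp_space p. S (\<lambda>n. c * f n) = (\<lambda>n. c * S f n)) \<and>
        (\<exists>C. \<forall>f\<in>lp_space p. lp_norm q (S f) \<le> C * lp_norm p f)}"

end

theory Submission
  imports Defs
begin

text \<open>
  By duality the \<open>\<ell>\<^sup>p\<close>-\<open>\<ell>\<^sup>q\<close> bound amounts to an estimate of the integral of
  \<open>|m| |F| |G|\<close> over the torus, where \<open>F\<close> and \<open>G\<close> are trigonometric polynomials with
  coefficients \<open>a\<close> and \<open>b\<close>, by the \<open>\<ell>\<^sup>p\<close> norm of \<open>a\<close> and the \<open>\<ell>\<^sup>u\<close> norm of
  \<open>b\<close>; here \<open>u\<close> is the exponent conjugate to \<open>q\<close>. Both \<open>p\<close> and \<open>u\<close> lie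
  in the interval from 1 to 2, and \<open>1/p + 1/u - 1 = 1/\<alpha>\<close>. Hence
  \<open>|m| = |m| powr (\<alpha> (1/p - 1/2)) * |m| powr (\<alpha> (1/u - 1/2))\<close>, and the Cauchy--Schwarz inequality
  (\<open>bilinear_bound\<close>) leaves two estimates of one form: for \<open>p\<close> between 1 and 2 and a
  weight \<open>w\<close> of weak type \<open>r = p / (2 - p)\<close>, or bounded by 1 if \<open>p = 2\<close>,
  the integral of \<open>w |F|\<^sup>2\<close> is at most a constant times the square of the \<open>\<ell>\<^sup>p\<close> norm
  of \<open>a\<close>.

  This is a form of the Hardy--Littlewood--Paley inequality, and it is the heart of the matter
  (\<open>paley_inequality\<close>). Write \<open>w\<close> as an integral over its level sets
  \<open>{s \<le> w}\<close>, whose measure is at most \<open>c * s powr - r\<close>. For each height \<open>s\<close> split the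
  coefficients by size, at a cutoff that depends on \<open>s\<close>. The part of \<open>F\<close> with large coefficients is
  bounded pointwise by the sum of their absolute values, and the smallness of the level set pays for
  this; the other part is estimated in \<open>L\<^sup>2\<close> by Bessel's inequality. With the right cutoff all
  integrals over \<open>s\<close> are elementary and the sums collapse to powers of the norm of \<open>a\<close>.
  The characters enter only through orthonormality and the bound 1, so this part is carried out for
  any bounded system of functions with Bessel's inequality on a finite measure space.

  The estimates concern finite sections of the matrix of the multiplier operator with respect to the
  unit vectors, with a uniform constant. For such a matrix the rows are absolutely summable
  against \<open>\<ell>\<^sup>p\<close> sequences (\<open>row_abs_sum_bound\<close>), so that the matrix itself defines the
  bounded extension (\<open>matrix_op_bounded_operator\<close>), and the density of finitely supported
  sequences gives uniqueness (\<open>bounded_lp_operators_eqI\<close>).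
\<close>

section \<open>Finite sections of the \<open>\<ell>\<^sup>p\<close> norm\<close>

text \<open>
  The estimates are first proved for finite sums, over an arbitrary index type and with constants
  that do not depend on the index set; the passage to \<open>lp_norm\<close> is a supremum over finite sets.
\<close>
definition fin_norm :: "real \<Rightarrow> 'i set \<Rightarrow> ('i \<Rightarrow> complex) \<Rightarrow> real" where
  "fin_norm p F f = (\<Sum>n\<in>F. cmod (f n) powr p) powr (1 / p)"

lemma fin_norm_nonneg [simp]: "0 \<le> fin_norm p F f"
  by (simp add: fin_norm_def)

lemma fin_norm_powr:
  assumes "p > 0"
  shows "fin_norm p F f powr p = (\<Sum>n\<in>F. cmod (f n) powr p)"
  using assms by (simp add: fin_norm_def powr_powr sum_nonneg)

lemma fin_norm_singleton:
  "p > 0 \<Longrightarrow> fin_norm p {n} a = cmod (a n)"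
  by (simp add: fin_norm_def powr_powr)

lemma fin_norm_mono:
  assumes "\<And>n. n \<in> F \<Longrightarrow> cmod (f n) \<le> cmod (g n)" "0 < p"
  shows "fin_norm p F f \<le> fin_norm p F g"
  unfolding fin_norm_def using assms
  by (intro powr_mono2 sum_mono) (auto intro!: sum_nonneg)

section \<open>Paley's inequality for bounded systems with Bessel's inequality\<close>

lemma nn_integral_powr_tail:
  fixes a r :: real
  assumes "0 < a" "1 < r"
  shows "(\<integral>\<^sup>+s. ennreal (s powr (-r)) * indicator {a..} s \<partial>lborel) = ennreal (a powr (1 - r) / (r - 1))"
proof -
  have "((\<lambda>s. s powr (1 - r)) \<longlongrightarrow> 0) at_top"
    using assms by (intro tendsto_neg_powr filterlim_ident) auto
  then have lim: "((\<lambda>s. s powr (1 - r) / (1 - r)) \<longlongrightarrow> 0 / (1 - r)) at_top"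
    by (rule tendsto_divide[OF _ tendsto_const]) (use assms in auto)
  have der: "((\<lambda>s. s powr (1 - r) / (1 - r)) has_real_derivative x powr (-r)) (at x)" if "a \<le> x" for x
  proof -
    have "x > 0" using that assms by simp
    then have "((\<lambda>s. s powr (1 - r)) has_real_derivative (1 - r) * x powr (1 - r - 1)) (at x)"
      by (rule has_real_derivative_powr)
    from DERIV_cdivide[OF this, of "1 - r"] show ?thesis using assms by simp
  qed
  have "(\<integral>\<^sup>+s. ennreal (s powr (-r)) * indicator {a..} s \<partial>lborel)
      = 0 / (1 - r) - a powr (1 - r) / (1 - r)"
    by (rule nn_integral_FTC_atLeast[OF _ der _ lim]) auto
  also have "0 / (1 - r) - a powr (1 - r) / (1 - r) = a powr (1 - r) / (r - 1)"
    using assms by (simp add: field_simps)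
  finally show ?thesis .
qed

text \<open>
  The only properties of the characters that enter the weighted estimate: a uniform bound, which
  controls a sum by the \<open>\<ell>\<^sup>1\<close> norm of its coefficients, and Bessel's inequality, which
  controls its \<open>L\<^sup>2\<close> norm by the \<open>\<ell>\<^sup>2\<close> norm of its coefficients.
\<close>
locale bounded_bessel_system = finite_measure M for M :: "'x measure" +
  fixes e :: "'i \<Rightarrow> 'x \<Rightarrow> complex"
  assumes e_measurable [measurable]: "\<And>n. e n \<in> borel_measurable M"
    and e_bounded: "\<And>n x. x \<in> space M \<Longrightarrow> cmod (e n x) \<le> 1"
    and bessel: "\<And>F a. finite F \<Longrightarrow>
      (\<integral>\<^sup>+x. ennreal ((cmod (\<Sum>n\<in>F. a n * e n x))\<^sup>2) \<partial>M) \<le> ennreal (\<Sum>n\<in>F. (cmod (a n))\<^sup>2)"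
begin

lemma sum_bounded_by_l1:
  assumes "x \<in> space M"
  shows "cmod (\<Sum>n\<in>F. a n * e n x) \<le> (\<Sum>n\<in>F. cmod (a n))"
proof (rule order_trans[OF norm_sum sum_mono])
  fix n show "cmod (a n * e n x) \<le> cmod (a n)"
    using mult_left_le[OF e_bounded[OF assms, of n], of "cmod (a n)"] by (simp add: norm_mult)
qed

text \<open>
  The coefficients in \<open>H\<close> (later: the large ones) are paid for with the supremum bound and the
  measure of \<open>E\<close>, the others with Bessel's inequality.
\<close>
lemma level_set_estimate:
  assumes "finite F" "H \<subseteq> F" and E [measurable]: "E \<in> sets M"
    and b: "emeasure M E \<le> ennreal b" "0 \<le> b"
  shows "(\<integral>\<^sup>+x. indicator E x * ennreal ((cmod (\<Sum>n\<in>F. a n * e n x))\<^sup>2) \<partial>M)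
    \<le> ennreal (2 * b * (\<Sum>n\<in>H. cmod (a n))\<^sup>2 + 2 * (\<Sum>n\<in>F - H. (cmod (a n))\<^sup>2))"
proof -
  let ?g = "\<lambda>H x. \<Sum>n\<in>H. a n * e n x"
  let ?L = "(\<Sum>n\<in>H. cmod (a n))\<^sup>2"
  have "(\<integral>\<^sup>+x. indicator E x * ennreal ((cmod (?g F x))\<^sup>2) \<partial>M)
      \<le> (\<integral>\<^sup>+x. ennreal (2 * ?L) * indicator E x + 2 * ennreal ((cmod (?g (F - H) x))\<^sup>2) \<partial>M)"
  proof (rule nn_integral_mono)
    fix x assume x: "x \<in> space M"
    have "?g F x = ?g H x + ?g (F - H) x"
      using assms(1,2) by (metis add.commute sum.subset_diff)
    then have "(cmod (?g F x))\<^sup>2 \<le> (cmod (?g H x) + cmod (?g (F - H) x))\<^sup>2"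
      by (simp add: norm_triangle_ineq power_mono)
    also have "\<dots> \<le> 2 * (cmod (?g H x))\<^sup>2 + 2 * (cmod (?g (F - H) x))\<^sup>2"
      by (smt (verit) power2_sum sum_squares_bound)
    also have "(cmod (?g H x))\<^sup>2 \<le> ?L"
      by (rule power_mono[OF sum_bounded_by_l1[OF x]]) simp
    finally have "(cmod (?g F x))\<^sup>2 \<le> 2 * ?L + 2 * (cmod (?g (F - H) x))\<^sup>2" by simp
    then have "ennreal ((cmod (?g F x))\<^sup>2) \<le> ennreal (2 * ?L) + 2 * ennreal ((cmod (?g (F - H) x))\<^sup>2)"
      by (subst ennreal_numeral[symmetric], subst ennreal_mult[symmetric])
         (auto simp: ennreal_plus[symmetric] simp del: ennreal_plus intro!: ennreal_leI)
    then show "indicator E x * ennreal ((cmod (?g F x))\<^sup>2)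
        \<le> ennreal (2 * ?L) * indicator E x + 2 * ennreal ((cmod (?g (F - H) x))\<^sup>2)"
      by (auto split: split_indicator)
  qed
  also have "\<dots> = ennreal (2 * ?L) * emeasure M E
      + 2 * (\<integral>\<^sup>+x. ennreal ((cmod (?g (F - H) x))\<^sup>2) \<partial>M)"
    by (subst nn_integral_add) (auto simp: nn_integral_cmult nn_integral_cmult_indicator)
  also have "\<dots> \<le> ennreal (2 * ?L) * ennreal b + 2 * ennreal (\<Sum>n\<in>F - H. (cmod (a n))\<^sup>2)"
    by (intro add_mono mult_left_mono b bessel) (use assms in auto)
  also have "\<dots> = ennreal (2 * b * ?L + 2 * (\<Sum>n\<in>F - H. (cmod (a n))\<^sup>2))"
  proof -
    have 2: "2 * ennreal x = ennreal (2 * x)" if "0 \<le> x" for x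
      using that by (simp add: ennreal_mult)
    show ?thesis
      using b by (subst 2) (simp_all add: ennreal_mult[symmetric] sum_nonneg mult_ac)
  qed
  finally show ?thesis .
qed

lemma layer_cake:
  assumes [measurable]: "w \<in> borel_measurable M" "h \<in> borel_measurable M"
  shows "(\<integral>\<^sup>+x. ennreal (w x) * h x \<partial>M)
    = (\<integral>\<^sup>+s. indicator {0<..} s * (\<integral>\<^sup>+x. indicator {x\<in>space M. s \<le> w x} x * h x \<partial>M) \<partial>lborel)"
proof -
  interpret pair_sigma_finite lborel M ..
  have "(\<integral>\<^sup>+x. ennreal (w x) * h x \<partial>M) = (\<integral>\<^sup>+x. (\<integral>\<^sup>+s. indicator {0<..w x} s * h x \<partial>lborel) \<partial>M)"
  proof (rule nn_integral_cong)
    fix x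
    have "emeasure lborel {0<..w x} = ennreal (w x)"
      by (cases "0 \<le> w x") (auto simp: ennreal_neg)
    then show "ennreal (w x) * h x = (\<integral>\<^sup>+s. indicator {0<..w x} s * h x \<partial>lborel)"
      by (simp add: nn_integral_multc)
  qed
  also have "\<dots> = (\<integral>\<^sup>+x. (\<integral>\<^sup>+s. indicator {y. 0 < fst y \<and> fst y \<le> w (snd y)} (s, x) * h x \<partial>lborel) \<partial>M)"
    by (intro nn_integral_cong) (auto split: split_indicator)
  also have "\<dots> = (\<integral>\<^sup>+s. (\<integral>\<^sup>+x. indicator {y. 0 < fst y \<and> fst y \<le> w (snd y)} (s, x) * h x \<partial>M) \<partial>lborel)"
    by (rule Fubini') measurable
  also have "\<dots> = (\<integral>\<^sup>+s. (\<integral>\<^sup>+x. indicator {0<..} s * (indicator {x\<in>space M. s \<le> w x} x * h x) \<partial>M) \<partial>lborel)"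
    by (intro nn_integral_cong) (auto split: split_indicator)
  also have "\<dots> = (\<integral>\<^sup>+s. indicator {0<..} s * (\<integral>\<^sup>+x. indicator {x\<in>space M. s \<le> w x} x * h x \<partial>M) \<partial>lborel)"
    by (intro nn_integral_cong nn_integral_cmult) measurable
  finally show ?thesis .
qed

text \<open>
  The layer-cake formula turns the weight into an integral over its level sets. On the level set at
  height \<open>s\<close> the sum is split into the indices with \<open>t n \<le> s\<close> and the others, where \<open>t\<close> is still
  free. The \<open>s\<close>-integrals are then elementary: a pair \<open>n, k\<close> of indices contributes the integral of
  \<open>s powr - r\<close> over \<open>{max (t n) (t k)..}\<close>, and a single index \<open>n\<close> contributes the length of
  \<open>{0<..<t n}\<close>.
\<close>
lemma paley_thresholds:
  fixes t :: "'i \<Rightarrow> real"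
  assumes F: "finite F" and t: "\<And>n. n \<in> F \<Longrightarrow> 0 < t n" and r: "1 < r" and c: "0 \<le> c"
    and w [measurable]: "w \<in> borel_measurable M"
    and weak: "\<And>s. 0 < s \<Longrightarrow> emeasure M {x\<in>space M. s \<le> w x} \<le> ennreal (c * s powr (-r))"
  shows "(\<integral>\<^sup>+x. ennreal (w x) * ennreal ((cmod (\<Sum>n\<in>F. a n * e n x))\<^sup>2) \<partial>M)
    \<le> ennreal (2 * c / (r - 1) * (\<Sum>n\<in>F. \<Sum>k\<in>F. cmod (a n) * cmod (a k) * max (t n) (t k) powr (1 - r))
        + 2 * (\<Sum>n\<in>F. (cmod (a n))\<^sup>2 * t n))"
proof -
  let ?h = "\<lambda>x. ennreal ((cmod (\<Sum>n\<in>F. a n * e n x))\<^sup>2)"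
  let ?B = "\<lambda>s. (\<Sum>n\<in>F. \<Sum>k\<in>F. ennreal (2 * c * (cmod (a n) * cmod (a k))) *
      (ennreal (s powr (-r)) * indicator {max (t n) (t k)..} s))
    + (\<Sum>n\<in>F. ennreal (2 * (cmod (a n))\<^sup>2) * indicator {0<..<t n} s)"
  have "(\<integral>\<^sup>+x. ennreal (w x) * ?h x \<partial>M)
     = (\<integral>\<^sup>+s. indicator {0<..} s * (\<integral>\<^sup>+x. indicator {x\<in>space M. s \<le> w x} x * ?h x \<partial>M) \<partial>lborel)"
    by (rule layer_cake) measurable
  also have "\<dots> \<le> (\<integral>\<^sup>+s. ?B s \<partial>lborel)"
  proof (rule nn_integral_mono)
    fix s :: real
    show "indicator {0<..} s * (\<integral>\<^sup>+x. indicator {x\<in>space M. s \<le> w x} x * ?h x \<partial>M) \<le> ?B s"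
    proof (cases "0 < s")
      case True
      define H where "H = {n\<in>F. t n \<le> s}"
      have "(\<integral>\<^sup>+x. indicator {x\<in>space M. s \<le> w x} x * ?h x \<partial>M) \<le>
        ennreal (2 * (c * s powr (-r)) * (\<Sum>n\<in>H. cmod (a n))\<^sup>2 + 2 * (\<Sum>n\<in>F - H. (cmod (a n))\<^sup>2))"
        by (rule level_set_estimate) (use F True weak c in \<open>auto simp: H_def\<close>)
      also have "(\<Sum>n\<in>H. cmod (a n))\<^sup>2 = (\<Sum>n\<in>F. \<Sum>k\<in>F. cmod (a n) * cmod (a k) * indicator {max (t n) (t k)..} s)"
      proof -
        have "(\<Sum>n\<in>H. cmod (a n)) = (\<Sum>n\<in>F. cmod (a n) * indicator {t n..} s)"
          unfolding H_def using F by (intro sum.mono_neutral_cong_left) auto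
        then show ?thesis
          by (simp add: power2_eq_square sum_product)
             (intro sum.cong refl, auto split: split_indicator)
      qed
      also have "(\<Sum>n\<in>F - H. (cmod (a n))\<^sup>2) = (\<Sum>n\<in>F. (cmod (a n))\<^sup>2 * indicator {0<..<t n} s)"
        unfolding H_def using F True by (intro sum.mono_neutral_cong_left) auto
      also have "ennreal (2 * (c * s powr (-r)) *
            (\<Sum>n\<in>F. \<Sum>k\<in>F. cmod (a n) * cmod (a k) * indicator {max (t n) (t k)..} s)
          + 2 * (\<Sum>n\<in>F. (cmod (a n))\<^sup>2 * indicator {0<..<t n} s)) = 
          ennreal ((\<Sum>n\<in>F. \<Sum>k\<in>F. 2 * c * (cmod (a n) * cmod (a k)) * (s powr (-r) * indicator {max (t n) (t k)..} s))
          + (\<Sum>n\<in>F. 2 * (cmod (a n))\<^sup>2 * indicator {0<..<t n} s))"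
        by (simp add: sum_distrib_left mult_ac)
      also have "\<dots> = ?B s"
      proof -
        have 1: "ennreal (2 * c * (cmod (a n) * cmod (a k))) * (ennreal (s powr (-r)) * indicator {max (t n) (t k)..} s)
            = ennreal (2 * c * (cmod (a n) * cmod (a k)) * (s powr (-r) * indicator {max (t n) (t k)..} s))" for n k
          by (auto simp: ennreal_mult'' split: split_indicator)
        have 2: "ennreal (2 * (cmod (a n))\<^sup>2) * indicator {0<..<t n} s
            = ennreal (2 * (cmod (a n))\<^sup>2 * indicator {0<..<t n} s)" for n
          by (auto split: split_indicator)
        show ?thesis unfolding 1 2 using c
          by (simp add: sum_ennreal sum_nonneg)
      qed
      finally show ?thesis using True by simp
    qed auto
  qed
  also have "\<dots> = (\<Sum>n\<in>F. \<Sum>k\<in>F. ennreal (2 * c * (cmod (a n) * cmod (a k))) *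
       (\<integral>\<^sup>+s. ennreal (s powr (-r)) * indicator {max (t n) (t k)..} s \<partial>lborel))
     + (\<Sum>n\<in>F. ennreal (2 * (cmod (a n))\<^sup>2) * emeasure lborel {0<..<t n})"
    by (simp add: nn_integral_add nn_integral_sum nn_integral_cmult nn_integral_cmult_indicator)
  also have "\<dots> = (\<Sum>n\<in>F. \<Sum>k\<in>F. ennreal (2 * c * (cmod (a n) * cmod (a k))) *
       ennreal (max (t n) (t k) powr (1 - r) / (r - 1)))
     + (\<Sum>n\<in>F. ennreal (2 * (cmod (a n))\<^sup>2) * ennreal (t n))"
    using t r by (intro arg_cong2[where f = "(+)"] sum.cong refl)
      (auto simp: nn_integral_powr_tail less_max_iff_disj less_imp_le)
  also have "\<dots> = ennreal ((\<Sum>n\<in>F. \<Sum>k\<in>F. 2 * c * (cmod (a n) * cmod (a k)) *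
       (max (t n) (t k) powr (1 - r) / (r - 1))) + (\<Sum>n\<in>F. 2 * (cmod (a n))\<^sup>2 * t n))"
  proof -
    have 1: "ennreal (2 * c * (cmod (a n) * cmod (a k))) * ennreal (max (t n) (t k) powr (1 - r) / (r - 1))
        = ennreal (2 * c * (cmod (a n) * cmod (a k)) * (max (t n) (t k) powr (1 - r) / (r - 1)))" for n k
      using c r by (intro ennreal_mult[symmetric]) auto
    have 2: "(\<Sum>n\<in>F. ennreal (2 * (cmod (a n))\<^sup>2) * ennreal (t n)) = (\<Sum>n\<in>F. ennreal (2 * (cmod (a n))\<^sup>2 * t n))"
      using t by (intro sum.cong refl ennreal_mult[symmetric]) (auto simp: less_imp_le)
    show ?thesis unfolding 1 2 using c r t
      by (simp add: sum_ennreal sum_nonneg less_imp_le)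
  qed
  also have "(\<Sum>n\<in>F. \<Sum>k\<in>F. 2 * c * (cmod (a n) * cmod (a k)) *
       (max (t n) (t k) powr (1 - r) / (r - 1))) + (\<Sum>n\<in>F. 2 * (cmod (a n))\<^sup>2 * t n)
     = 2 * c / (r - 1) * (\<Sum>n\<in>F. \<Sum>k\<in>F. cmod (a n) * cmod (a k) * max (t n) (t k) powr (1 - r))
        + 2 * (\<Sum>n\<in>F. (cmod (a n))\<^sup>2 * t n)"
    by (simp add: sum_distrib_left mult_ac)
  finally show ?thesis .
qed

text \<open>
  With \<open>A\<close> the \<open>\<ell>\<^sup>p\<close> norm of \<open>a\<close>, the threshold \<open>t n = (A / |a n|) powr (2 - p)\<close> makes
  \<open>|a n|\<^sup>2 * t n\<close> a multiple of \<open>|a n| powr p\<close>. The same choice handles the double sum: the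
  exponent \<open>1 - r\<close> is negative, so the power of the maximum of two thresholds is at most the geometric
  mean of the two powers, and the exponents are such that the sum then becomes a power of \<open>A\<close> times
  \<open>(\<Sum>n\<in>F. |a n| powr p)\<^sup>2\<close>.
\<close>
lemma paley_inequality:
  assumes p: "1 < p" "p < 2" and F: "finite F" and c: "0 \<le> c"
    and w: "w \<in> borel_measurable M"
    and weak: "\<And>s. 0 < s \<Longrightarrow> emeasure M {x\<in>space M. s \<le> w x} \<le> ennreal (c * s powr (- (p / (2 - p))))"
  shows "(\<integral>\<^sup>+x. ennreal (w x) * ennreal ((cmod (\<Sum>n\<in>F. a n * e n x))\<^sup>2) \<partial>M)
    \<le> ennreal ((c * (2 - p) / (p - 1) + 2) * (fin_norm p F a)\<^sup>2)"
proof -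
  \<comment> \<open>Thresholds have to be positive and finite, so vanishing coefficients are discarded.\<close>
  define F' where "F' = {n\<in>F. a n \<noteq> 0}"
  define A where "A = fin_norm p F a"
  define r where "r = p / (2 - p)"
  define t where "t = (\<lambda>n. (A / cmod (a n)) powr (2 - p))"
  have F': "finite F'" using F by (simp add: F'_def)
  have AF': "A powr p = (\<Sum>n\<in>F'. cmod (a n) powr p)"
    unfolding A_def F'_def using p F
    by (subst fin_norm_powr) (auto intro!: sum.mono_neutral_right)
  have r: "1 < r" using p by (simp add: r_def field_simps)
  \<comment> \<open>This identity between the exponents makes the double sum factor.\<close>
  have r1: "(2 - p) * (1 - r) = 2 * (1 - p)" using p by (simp add: r_def field_simps)
  have Apos: "A > 0" if "n \<in> F'" for n
  proof -
    have "0 < cmod (a n) powr p" using that by (simp add: F'_def)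
    also have "\<dots> \<le> A powr p" unfolding AF' using that F' by (intro member_le_sum) auto
    finally show ?thesis using A_def fin_norm_nonneg[of p F a] by (cases "A = 0") (auto simp: less_le)
  qed
  have tpos: "0 < t n" if "n \<in> F'" for n
    using that Apos[OF that] by (auto simp: t_def F'_def)
  have tn: "(cmod (a n))\<^sup>2 * t n = A powr (2 - p) * cmod (a n) powr p" if "n \<in> F'" for n
  proof -
    have "cmod (a n) > 0" using that by (simp add: F'_def)
    then show ?thesis using Apos[OF that]
      by (simp add: t_def powr_divide powr_diff powr_numeral field_simps)
  qed
  have tnk: "cmod (a n) * cmod (a k) * max (t n) (t k) powr (1 - r)
      \<le> A powr (2 - 2 * p) * (cmod (a n) powr p * cmod (a k) powr p)" if "n \<in> F'" "k \<in> F'" for n k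
  proof -
    have r2: "(2 - p) * ((1 - r) / 2) = 1 - p" using r1 by simp
    have half: "t j powr ((1 - r) / 2) = A powr (1 - p) * cmod (a j) powr (p - 1)" if "j \<in> F'" for j
    proof -
      have "t j powr ((1 - r) / 2) = (A / cmod (a j)) powr ((2 - p) * ((1 - r) / 2))"
        by (simp only: t_def powr_powr)
      also have "\<dots> = (A / cmod (a j)) powr (1 - p)" by (simp only: r2)
      also have "\<dots> = A powr (1 - p) * cmod (a j) powr (p - 1)"
        using Apos[OF that] that by (simp add: F'_def powr_divide powr_diff)
      finally show ?thesis .
    qed
    have "max (t n) (t k) powr (1 - r) = max (t n) (t k) powr ((1 - r) / 2) * max (t n) (t k) powr ((1 - r) / 2)"
      by (simp flip: powr_add)
    also have "\<dots> \<le> t n powr ((1 - r) / 2) * t k powr ((1 - r) / 2)"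
      using r tpos that by (intro mult_mono powr_mono2') auto
    also have "\<dots> = A powr (2 - 2 * p) * (cmod (a n) powr (p - 1) * cmod (a k) powr (p - 1))"
      using half[OF that(1)] half[OF that(2)] powr_add[of A "1 - p" "1 - p"] by simp
    finally have "cmod (a n) * cmod (a k) * max (t n) (t k) powr (1 - r)
      \<le> cmod (a n) * cmod (a k) * (A powr (2 - 2 * p) * (cmod (a n) powr (p - 1) * cmod (a k) powr (p - 1)))"
      by (intro mult_left_mono) auto
    also have "\<dots> = A powr (2 - 2 * p) * (cmod (a n) powr p * cmod (a k) powr p)"
      using that by (simp add: F'_def powr_diff)
    finally show ?thesis .
  qed
  have A2: "A powr (2 - p) * A powr p = A\<^sup>2" "A powr (2 - 2 * p) * (A powr p * A powr p) = A\<^sup>2"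
    by (cases "A = 0"; simp add: A_def flip: powr_add powr_numeral)+
  have "(\<integral>\<^sup>+x. ennreal (w x) * ennreal ((cmod (\<Sum>n\<in>F. a n * e n x))\<^sup>2) \<partial>M)
      = (\<integral>\<^sup>+x. ennreal (w x) * ennreal ((cmod (\<Sum>n\<in>F'. a n * e n x))\<^sup>2) \<partial>M)"
  proof -
    have "(\<Sum>n\<in>F. a n * e n x) = (\<Sum>n\<in>F'. a n * e n x)" for x
      unfolding F'_def using F by (intro sum.mono_neutral_right) auto
    then show ?thesis by simp
  qed
  also have "\<dots> \<le> ennreal (2 * c / (r - 1) * (\<Sum>n\<in>F'. \<Sum>k\<in>F'. cmod (a n) * cmod (a k) * max (t n) (t k) powr (1 - r))
        + 2 * (\<Sum>n\<in>F'. (cmod (a n))\<^sup>2 * t n))"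
    by (rule paley_thresholds[OF F' tpos r c w weak[folded r_def]])
  also have "\<dots> \<le> ennreal (2 * c / (r - 1) * (\<Sum>n\<in>F'. \<Sum>k\<in>F'. A powr (2 - 2 * p) * (cmod (a n) powr p * cmod (a k) powr p))
        + 2 * (\<Sum>n\<in>F'. A powr (2 - p) * cmod (a n) powr p))"
    using c r by (intro ennreal_leI add_mono mult_left_mono sum_mono tnk)
      (auto simp: tn intro!: sum_mono)
  also have "(\<Sum>n\<in>F'. \<Sum>k\<in>F'. A powr (2 - 2 * p) * (cmod (a n) powr p * cmod (a k) powr p)) = A\<^sup>2"
    by (simp add: sum_distrib_left[symmetric] sum_distrib_right[symmetric] AF'[symmetric] A2)
  also have "(\<Sum>n\<in>F'. A powr (2 - p) * cmod (a n) powr p) = A\<^sup>2"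
    by (simp add: sum_distrib_left[symmetric] AF'[symmetric] A2)
  also have "2 * c / (r - 1) * A\<^sup>2 + 2 * A\<^sup>2 = (c * (2 - p) / (p - 1) + 2) * A\<^sup>2"
    using p by (simp add: r_def divide_simps) (simp add: algebra_simps)
  finally show ?thesis by (simp add: A_def)
qed

end

section \<open>The bilinear estimate\<close>

lemma ennreal_le_from_square:
  fixes I :: ennreal
  assumes "I\<^sup>2 \<le> ennreal (Y\<^sup>2)" "0 \<le> Y"
  shows "I \<le> ennreal Y"
proof (cases I)
  case (real r)
  then have "r\<^sup>2 \<le> Y\<^sup>2" using assms by (simp add: ennreal_power)
  then show ?thesis using real assms by (auto intro: ennreal_leI power2_le_imp_le)
next
  case top
  then show ?thesis using assms by (simp add: power2_eq_square ennreal_top_mult top_unique)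
qed

context bounded_bessel_system
begin

definition weak_type :: "real \<Rightarrow> real \<Rightarrow> ('x \<Rightarrow> complex) \<Rightarrow> bool" where
  "weak_type \<alpha> c m \<longleftrightarrow> m \<in> borel_measurable M \<and> 0 \<le> c \<and>
     (\<forall>s>0. emeasure M {x\<in>space M. s \<le> cmod (m x)} \<le> ennreal (c / s powr \<alpha>))"

text \<open>
  A power \<open>\<beta>\<close> of \<open>|m|\<close> is of weak type \<open>\<alpha> / \<beta>\<close>, and the exponent is chosen such that
  \<open>\<alpha> / \<beta> = p / (2 - p)\<close>, as in Paley's inequality. At \<open>p = 2\<close> the weight is at most 1
  and Bessel's inequality suffices.
\<close>
lemma weighted_L2_bound:
  assumes p: "1 < p" "p \<le> 2" and \<alpha>: "0 < \<alpha>" and m: "weak_type \<alpha> c m"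
  obtains C where "0 \<le> C"
    "\<And>F a. finite F \<Longrightarrow>
      (\<integral>\<^sup>+x. ennreal (cmod (m x) powr (\<alpha> * (2 / p - 1))) * ennreal ((cmod (\<Sum>n\<in>F. a n * e n x))\<^sup>2) \<partial>M)
        \<le> ennreal (C * (fin_norm p F a)\<^sup>2)"
proof -
  have [measurable]: "m \<in> borel_measurable M" and c: "0 \<le> c"
    and weak: "\<And>s. 0 < s \<Longrightarrow> emeasure M {x\<in>space M. s \<le> cmod (m x)} \<le> ennreal (c / s powr \<alpha>)"
    using m by (auto simp: weak_type_def)
  show thesis
  proof (cases "p = 2")
    case True
    show thesis
    proof (rule that[of 1])
      fix F :: "'i set" and a :: "'i \<Rightarrow> complex" assume F: "finite F"
      have "(\<integral>\<^sup>+x. ennreal (cmod (m x) powr (\<alpha> * (2 / p - 1))) * ennreal ((cmod (\<Sum>n\<in>F. a n * e n x))\<^sup>2) \<partial>M)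
        \<le> (\<integral>\<^sup>+x. ennreal ((cmod (\<Sum>n\<in>F. a n * e n x))\<^sup>2) \<partial>M)"
        unfolding True by (intro nn_integral_mono) auto
      also have "\<dots> \<le> ennreal (\<Sum>n\<in>F. (cmod (a n))\<^sup>2)" by (rule bessel[OF F])
      also have "(\<Sum>n\<in>F. (cmod (a n))\<^sup>2) = 1 * (fin_norm p F a)\<^sup>2"
        using fin_norm_powr[of 2 F a] by (simp add: True)
      finally show "(\<integral>\<^sup>+x. ennreal (cmod (m x) powr (\<alpha> * (2 / p - 1))) * ennreal ((cmod (\<Sum>n\<in>F. a n * e n x))\<^sup>2) \<partial>M)
        \<le> ennreal (1 * (fin_norm p F a)\<^sup>2)" .
    qed simp
  next
    case False
    then have p2: "p < 2" using p by simp
    define \<beta> where "\<beta> = \<alpha> * (2 / p - 1)"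
    have \<beta>: "0 < \<beta>" using p p2 \<alpha> by (simp add: \<beta>_def)
    have \<alpha>\<beta>: "1 / \<beta> * \<alpha> = p / (2 - p)" using p p2 \<alpha> by (simp add: \<beta>_def field_simps)
    have "emeasure M {x\<in>space M. s \<le> cmod (m x) powr \<beta>} \<le> ennreal (c * s powr (- (p / (2 - p))))" if s: "0 < s" for s
    proof -
      have "s \<le> y powr \<beta> \<longleftrightarrow> s powr (1 / \<beta>) \<le> y" if "0 \<le> y" for y
      proof -
        have "s \<le> y powr \<beta> \<longleftrightarrow> (s powr (1 / \<beta>)) powr \<beta> \<le> y powr \<beta>"
          using s \<beta> by (simp add: powr_powr)
        also have "\<dots> \<longleftrightarrow> s powr (1 / \<beta>) \<le> y"
          using \<beta> that by (meson linorder_not_less powr_ge_zero powr_less_mono2 powr_mono2 less_imp_le)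
        finally show ?thesis .
      qed
      then have "{x\<in>space M. s \<le> cmod (m x) powr \<beta>} = {x\<in>space M. s powr (1 / \<beta>) \<le> cmod (m x)}"
        by simp
      also have "emeasure M \<dots> \<le> ennreal (c / (s powr (1 / \<beta>)) powr \<alpha>)"
        using s by (intro weak) simp
      also have "c / (s powr (1 / \<beta>)) powr \<alpha> = c * s powr (- (p / (2 - p)))"
        unfolding powr_powr \<alpha>\<beta> by (simp add: powr_minus divide_inverse)
      finally show ?thesis .
    qed
    from paley_inequality[OF p(1) p2 _ c _ this]
    show thesis using p p2 c
      by (intro that[of "c * (2 - p) / (p - 1) + 2"]) (auto simp flip: \<beta>_def)
  qed
qed

text \<open>
  The relation between the exponents says exactly that \<open>|m|\<close> is the product of the square
  roots of the weights that belong to \<open>p\<close> and to \<open>u\<close>, so the Cauchy--Schwarz inequality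
  reduces the claim to the two weighted bounds.
\<close>
lemma bilinear_bound:
  assumes p: "1 < p" "p \<le> 2" and u: "1 < u" "u \<le> 2" and \<alpha>: "0 < \<alpha>"
    and pu: "1 / p + 1 / u - 1 = 1 / \<alpha>" and m: "weak_type \<alpha> c m"
  obtains C where "0 \<le> C"
    "\<And>F G a b. finite F \<Longrightarrow> finite G \<Longrightarrow>
      (\<integral>\<^sup>+x. ennreal (cmod (m x) * cmod (\<Sum>n\<in>F. a n * e n x) * cmod (\<Sum>k\<in>G. b k * e k x)) \<partial>M)
        \<le> ennreal (C * fin_norm p F a * fin_norm u G b)"
proof -
  have [measurable]: "m \<in> borel_measurable M" using m by (simp add: weak_type_def)
  obtain C1 where C1: "0 \<le> C1" "\<And>F a. finite F \<Longrightarrow>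
      (\<integral>\<^sup>+x. ennreal (cmod (m x) powr (\<alpha> * (2 / p - 1))) * ennreal ((cmod (\<Sum>n\<in>F. a n * e n x))\<^sup>2) \<partial>M)
        \<le> ennreal (C1 * (fin_norm p F a)\<^sup>2)"
    using weighted_L2_bound[OF p \<alpha> m] by blast
  obtain C2 where C2: "0 \<le> C2" "\<And>F a. finite F \<Longrightarrow>
      (\<integral>\<^sup>+x. ennreal (cmod (m x) powr (\<alpha> * (2 / u - 1))) * ennreal ((cmod (\<Sum>n\<in>F. a n * e n x))\<^sup>2) \<partial>M)
        \<le> ennreal (C2 * (fin_norm u F a)\<^sup>2)"
    using weighted_L2_bound[OF u \<alpha> m] by blast
  define \<beta> where "\<beta> = \<alpha> * (1 / p - 1 / 2)"
  define \<gamma> where "\<gamma> = \<alpha> * (1 / u - 1 / 2)"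
  have exps: "\<alpha> * (2 / p - 1) = \<beta> + \<beta>" "\<alpha> * (2 / u - 1) = \<gamma> + \<gamma>"
    by (simp_all add: \<beta>_def \<gamma>_def algebra_simps)
  have "\<beta> + \<gamma> = \<alpha> * (1 / p + 1 / u - 1)" by (simp add: \<beta>_def \<gamma>_def algebra_simps)
  then have \<beta>\<gamma>: "\<beta> + \<gamma> = 1" using pu \<alpha> by simp
  have split: "cmod z = cmod z powr \<beta> * cmod z powr \<gamma>" for z
    by (simp flip: powr_add add: \<beta>\<gamma>)
  show thesis
  proof (rule that[of "sqrt (C1 * C2)"])
    fix F G :: "'i set" and a b :: "'i \<Rightarrow> complex" assume FG: "finite F" "finite G"
    let ?f = "\<lambda>x. \<Sum>n\<in>F. a n * e n x" and ?g = "\<lambda>x. \<Sum>k\<in>G. b k * e k x"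
    let ?I = "\<integral>\<^sup>+x. ennreal (cmod (m x) * cmod (?f x) * cmod (?g x)) \<partial>M"
    have "?I\<^sup>2 = (\<integral>\<^sup>+x. ennreal (cmod (m x) powr \<beta> * cmod (?f x)) * ennreal (cmod (m x) powr \<gamma> * cmod (?g x)) \<partial>M)\<^sup>2"
      by (subst split) (simp add: ennreal_mult[symmetric] mult_ac)
    also have "\<dots> \<le> (\<integral>\<^sup>+x. (ennreal (cmod (m x) powr \<beta> * cmod (?f x)))\<^sup>2 \<partial>M)
        * (\<integral>\<^sup>+x. (ennreal (cmod (m x) powr \<gamma> * cmod (?g x)))\<^sup>2 \<partial>M)"
      by (rule Cauchy_Schwarz_nn_integral) measurable
    also have "\<dots> = (\<integral>\<^sup>+x. ennreal (cmod (m x) powr (\<alpha> * (2 / p - 1))) * ennreal ((cmod (?f x))\<^sup>2) \<partial>M)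
        * (\<integral>\<^sup>+x. ennreal (cmod (m x) powr (\<alpha> * (2 / u - 1))) * ennreal ((cmod (?g x))\<^sup>2) \<partial>M)"
      unfolding exps powr_add
      by (simp add: ennreal_power ennreal_mult[symmetric] power2_eq_square mult_ac)
    also have "\<dots> \<le> ennreal (C1 * (fin_norm p F a)\<^sup>2) * ennreal (C2 * (fin_norm u G b)\<^sup>2)"
      by (intro mult_mono C1 C2 FG) auto
    also have "\<dots> = ennreal ((sqrt (C1 * C2) * fin_norm p F a * fin_norm u G b)\<^sup>2)"
      using C1(1) C2(1) by (simp add: ennreal_mult[symmetric] power_mult_distrib mult_ac)
    finally show "?I \<le> ennreal (sqrt (C1 * C2) * fin_norm p F a * fin_norm u G b)"
      by (rule ennreal_le_from_square) (use C1 C2 in simp)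
  qed (use C1 C2 in simp)
qed

definition multiplier_matrix :: "('x \<Rightarrow> complex) \<Rightarrow> 'i \<Rightarrow> 'i \<Rightarrow> complex" where
  "multiplier_matrix m k n = (LINT x|M. m x * e n x * cnj (e k x))"

text \<open>
  Duality. With \<open>u\<close> the exponent conjugate to \<open>q\<close>, the bilinear bound is tested against
  the extremizer \<open>g = sgn T * |T| powr (q - 1)\<close> of the pairing with \<open>T\<close>. This gives
  \<open>N \<le> C * fin_norm p F a * N powr (1 - 1 / q)\<close> for \<open>N = (\<Sum>k\<in>G. |T k| powr q)\<close>, and one divides.
  Testing against unit vectors shows that the integrals defining the matrix converge.
\<close>
lemma multiplier_matrix_bound:
  assumes p: "1 < p" "p \<le> 2" and q: "2 \<le> q" and \<alpha>: "0 < \<alpha>"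
    and pq: "1 / p - 1 / q = 1 / \<alpha>" and m: "weak_type \<alpha> c m"
  shows "integrable M (\<lambda>x. m x * e n x * cnj (e k x))"
    and "\<exists>C\<ge>0. \<forall>F G a. finite F \<longrightarrow> finite G \<longrightarrow>
      fin_norm q G (\<lambda>k. \<Sum>n\<in>F. multiplier_matrix m k n * a n) \<le> C * fin_norm p F a"
proof -
  have [measurable]: "m \<in> borel_measurable M" using m by (simp add: weak_type_def)
  define u where "u = q / (q - 1)"
  have u: "1 < u" "u \<le> 2" and qu: "(q - 1) * u = q" and u1: "1 / u = 1 - 1 / q"
    using q by (auto simp: u_def field_simps)
  have "1 / p + 1 / u - 1 = 1 / \<alpha>" using pq u1 by simp
  from bilinear_bound[OF p u \<alpha> this m] obtain C where C: "0 \<le> C" 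
    "\<And>F G a b. finite F \<Longrightarrow> finite G \<Longrightarrow>
      (\<integral>\<^sup>+x. ennreal (cmod (m x) * cmod (\<Sum>n\<in>F. a n * e n x) * cmod (\<Sum>k\<in>G. b k * e k x)) \<partial>M)
        \<le> ennreal (C * fin_norm p F a * fin_norm u G b)"
    by blast
  show int: "integrable M (\<lambda>x. m x * e n x * cnj (e k x))" for n k
  proof -
    have [measurable]: "(\<lambda>x. cnj (e k x)) \<in> borel_measurable M"
      by (rule measurable_compose[OF e_measurable borel_measurable_continuous_onI]) (intro continuous_intros)
    have "(\<integral>\<^sup>+x. ennreal (cmod (m x * e n x * cnj (e k x))) \<partial>M) \<le> ennreal C"
      using C(2)[of "{n}" "{k}" "\<lambda>_. 1" "\<lambda>_. 1"] p u
      by (simp add: norm_mult fin_norm_singleton)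
    then show ?thesis
      by (auto simp: integrable_iff_bounded intro: le_less_trans)
  qed
  show "\<exists>C\<ge>0. \<forall>F G a. finite F \<longrightarrow> finite G \<longrightarrow>
      fin_norm q G (\<lambda>k. \<Sum>n\<in>F. multiplier_matrix m k n * a n) \<le> C * fin_norm p F a"
  proof (intro exI[of _ C] conjI allI impI C(1))
    fix F G :: "'i set" and a :: "'i \<Rightarrow> complex" assume FG: "finite F" "finite G"
    define T where "T = (\<lambda>k. \<Sum>n\<in>F. multiplier_matrix m k n * a n)"
    define N where "N = (\<Sum>k\<in>G. cmod (T k) powr q)"
    define g where "g = (\<lambda>k. sgn (T k) * of_real (cmod (T k) powr (q - 1)))"
    have g_norm: "cmod (g k) = cmod (T k) powr (q - 1)" for k
      by (cases "T k = 0") (auto simp: g_def norm_mult norm_sgn)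
    have Tg: "T k * cnj (g k) = of_real (cmod (T k) powr q)" for k
    proof (cases "T k = 0")
      case False
      have "T k * cnj (g k) = (T k * cnj (T k)) / of_real (cmod (T k)) * of_real (cmod (T k) powr (q - 1))"
        by (simp add: g_def sgn_div_norm scaleR_conv_of_real field_simps)
      also have "\<dots> = of_real (cmod (T k) * cmod (T k) powr (q - 1))"
        using False by (simp add: complex_norm_square[symmetric] power2_eq_square)
      also have "cmod (T k) * cmod (T k) powr (q - 1) = cmod (T k) powr q"
        using False by (simp add: powr_diff)
      finally show ?thesis .
    qed (simp add: g_def)
    let ?f = "\<lambda>x. \<Sum>n\<in>F. a n * e n x" and ?g = "\<lambda>x. \<Sum>k\<in>G. g k * e k x"
    have expand: "m x * ?f x * cnj (?g x)
        = (\<Sum>k\<in>G. \<Sum>n\<in>F. a n * cnj (g k) * (m x * e n x * cnj (e k x)))" for x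
      by (simp add: sum_distrib_left sum_distrib_right sum.swap[of _ F G] mult_ac)
    have int2: "integrable M (\<lambda>x. m x * ?f x * cnj (?g x))"
      unfolding expand using int by (intro Bochner_Integration.integrable_sum) auto
    have "of_real N = (\<Sum>k\<in>G. T k * cnj (g k))" by (simp add: N_def Tg)
    also have "\<dots> = (\<Sum>k\<in>G. \<Sum>n\<in>F. a n * cnj (g k) * multiplier_matrix m k n)"
      unfolding T_def sum_distrib_right by (intro sum.cong refl) (simp only: mult_ac)
    also have "\<dots> = (LINT x|M. m x * ?f x * cnj (?g x))"
      unfolding expand multiplier_matrix_def using int by (simp add: Bochner_Integration.integral_sum)
    finally have Neq: "(LINT x|M. m x * ?f x * cnj (?g x)) = of_real N" ..
    have "0 \<le> N" by (simp add: N_def sum_nonneg)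
    then have "ennreal N = ennreal (cmod (LINT x|M. m x * ?f x * cnj (?g x)))"
      unfolding Neq norm_of_real by simp
    also have "\<dots> \<le> (\<integral>\<^sup>+x. ennreal (cmod (m x * ?f x * cnj (?g x))) \<partial>M)"
      by (rule integral_norm_bound_ennreal[OF int2])
    also have "\<dots> \<le> ennreal (C * fin_norm p F a * fin_norm u G g)"
      using C(2)[OF FG, of a g] by (simp only: norm_mult complex_mod_cnj)
    finally have "N \<le> C * fin_norm p F a * fin_norm u G g"
      using C(1) by (simp add: ennreal_le_iff)
    moreover have "fin_norm u G g = N powr (1 - 1 / q)"
      by (simp add: fin_norm_def g_norm powr_powr qu N_def u1)
    ultimately have N: "N \<le> C * fin_norm p F a * N powr (1 - 1 / q)" by simp
    have "N powr (1 / q) \<le> C * fin_norm p F a"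
    proof (cases "N = 0")
      case True then show ?thesis using C(1) by simp
    next
      case False
      then have Npos: "N > 0" by (simp add: N_def less_le sum_nonneg)
      have "N powr (1 / q) * N powr (1 - 1 / q) = N" using Npos by (simp flip: powr_add)
      with N have "N powr (1 / q) * N powr (1 - 1 / q) \<le> C * fin_norm p F a * N powr (1 - 1 / q)" by simp
      then show ?thesis using Npos by (simp add: mult_le_cancel_right)
    qed
    then show "fin_norm q G (\<lambda>k. \<Sum>n\<in>F. multiplier_matrix m k n * a n) \<le> C * fin_norm p F a"
      by (simp add: fin_norm_def N_def T_def)
  qed
qed

end

section \<open>\<open>\<ell>\<^sup>p\<close> spaces on the lattice\<close>

lemma fin_norm_le_lp_norm:
  assumes "f \<in> lp_space p" "finite F" "0 < p"
  shows "fin_norm p F f \<le> lp_norm p f"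
  unfolding fin_norm_def lp_norm_def using assms
  by (intro powr_mono2 finite_sum_le_infsum) (auto simp: lp_space_def intro!: sum_nonneg)

lemma lp_norm_nonneg [simp]: "0 \<le> lp_norm p f"
  by (simp add: lp_norm_def)

lemma lp_space_finite_support:
  assumes "finite F" "\<And>n. n \<notin> F \<Longrightarrow> f n = 0"
  shows "f \<in> lp_space p"
proof -
  have "((\<lambda>n. cmod (f n) powr p) has_sum (\<Sum>n\<in>F. cmod (f n) powr p)) UNIV"
    using assms by (intro has_sum_finite_neutralI) auto
  then show ?thesis
    by (auto simp: lp_space_def summable_on_def)
qed

text \<open>
  Transfers the finite estimates to \<open>\<ell>\<^sup>q\<close>: membership comes with the bound.
\<close>
lemma lp_norm_bound_from_finite:
  assumes B: "\<And>G. finite G \<Longrightarrow> fin_norm q G h \<le> B" and q: "0 < q"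
  shows "h \<in> lp_space q" "lp_norm q h \<le> B"
proof -
  have B0: "0 \<le> B" using B[of "{}"] by (simp add: fin_norm_def)
  have le: "(\<Sum>n\<in>G. cmod (h n) powr q) \<le> B powr q" if "finite G" for G
    using powr_mono2[OF _ _ B[OF that], of q] q by (simp add: fin_norm_powr)
  show h: "h \<in> lp_space q"
    unfolding lp_space_def mem_Collect_eq
    by (rule nonneg_bdd_above_summable_on) (auto intro!: bdd_aboveI[of _ "B powr q"] le)
  then have "(\<Sum>\<^sub>\<infinity>n. cmod (h n) powr q) \<le> B powr q"
    using le by (intro infsum_le_finite_sums) (auto simp: lp_space_def)
  then have "lp_norm q h \<le> (B powr q) powr (1 / q)"
    unfolding lp_norm_def using q by (intro powr_mono2) (auto intro!: infsum_nonneg)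
  then show "lp_norm q h \<le> B" using q B0 by (simp add: powr_powr)
qed

lemma lp_space_add:
  assumes "f \<in> lp_space p" "g \<in> lp_space p" "0 < p"
  shows "(\<lambda>n. f n + g n) \<in> lp_space p"
proof -
  have "(\<lambda>n. 2 powr p * (cmod (f n) powr p + cmod (g n) powr p)) summable_on UNIV"
    using assms by (intro summable_on_cmult_right summable_on_add) (auto simp: lp_space_def)
  moreover have "cmod (f n + g n) powr p \<le> 2 powr p * (cmod (f n) powr p + cmod (g n) powr p)" for n
  proof -
    let ?M = "max (cmod (f n)) (cmod (g n))"
    have "cmod (f n + g n) \<le> 2 * ?M" using norm_triangle_ineq[of "f n" "g n"] by linarith
    then have "cmod (f n + g n) powr p \<le> (2 * ?M) powr p" using assms by (intro powr_mono2) auto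
    also have "\<dots> = 2 powr p * ?M powr p" by (simp add: powr_mult)
    also have "?M powr p \<le> cmod (f n) powr p + cmod (g n) powr p" by (simp add: max_def)
    finally show ?thesis by simp
  qed
  ultimately show ?thesis unfolding lp_space_def mem_Collect_eq
    by (rule summable_on_comparison_test) auto
qed

lemma lp_space_scale:
  assumes "f \<in> lp_space p"
  shows "(\<lambda>n. c * f n) \<in> lp_space p"
  using assms by (auto simp: lp_space_def norm_mult powr_mult intro: summable_on_cmult_right)

lemma lp_norm_tail_tendsto_0:
  assumes f: "f \<in> lp_space p" and p: "0 < p"
  shows "((\<lambda>F. lp_norm p (\<lambda>n. if n \<in> F then 0 else f n)) \<longlongrightarrow> 0) (finite_subsets_at_top UNIV)"
proof -
  let ?a = "\<lambda>n. cmod (f n) powr p"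
  have a: "?a summable_on UNIV" using f by (simp add: lp_space_def)
  have tail: "(\<Sum>\<^sub>\<infinity>n. cmod (if n \<in> F then 0 else f n) powr p) = infsum ?a UNIV - sum ?a F" if "finite F" for F
  proof -
    have "(\<Sum>\<^sub>\<infinity>n. cmod (if n \<in> F then 0 else f n) powr p) = infsum ?a (UNIV - F)"
      by (rule infsum_cong_neutral) auto
    also have "\<dots> = infsum ?a UNIV - infsum ?a F"
      using that a by (intro infsum_Diff) auto
    finally show ?thesis using that by simp
  qed
  have "((\<lambda>F. infsum ?a UNIV - sum ?a F) \<longlongrightarrow> infsum ?a UNIV - infsum ?a UNIV) (finite_subsets_at_top UNIV)"
    by (intro tendsto_diff tendsto_const infsum_tendsto a)
  then have "((\<lambda>F. \<Sum>\<^sub>\<infinity>n. cmod (if n \<in> F then 0 else f n) powr p) \<longlongrightarrow> 0) (finite_subsets_at_top UNIV)"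
    unfolding diff_self
    by (rule Lim_transform_eventually)
       (auto simp: eventually_finite_subsets_at_top intro!: exI[of _ "{}"] tail[symmetric])
  then have "((\<lambda>F. lp_norm p (\<lambda>n. if n \<in> F then 0 else f n)) \<longlongrightarrow> 0 powr (1 / p)) (finite_subsets_at_top UNIV)"
    unfolding lp_norm_def using p
    by (intro tendsto_powr' tendsto_const) (auto intro!: always_eventually infsum_nonneg)
  then show ?thesis by simp
qed

lemma cmod_le_lp_norm:
  assumes "f \<in> lp_space p" "0 < p"
  shows "cmod (f k) \<le> lp_norm p f"
  using fin_norm_le_lp_norm[OF assms(1), of "{k}"] assms by (simp add: fin_norm_singleton)

text \<open>
  Split \<open>f\<close> into its restriction to a finite set, where the operators agree, and the tail. Point
  evaluations are bounded on \<open>\<ell>\<^sup>q\<close>, so the values of the operators at \<open>f\<close> differ by at most a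
  multiple of the norm of the tail, which tends to 0.
\<close>
lemma bounded_lp_operators_eqI:
  assumes S: "S \<in> bounded_lp_operators p q" and T: "T \<in> bounded_lp_operators p q"
    and p: "0 < p" and q: "0 < q"
    and eq: "\<And>f. finitely_supported f \<Longrightarrow> S f = T f"
  shows "S = T"
proof (rule PiE_ext)
  show "S \<in> lp_space p \<rightarrow>\<^sub>E lp_space q" "T \<in> lp_space p \<rightarrow>\<^sub>E lp_space q"
    using S T by (auto simp: bounded_lp_operators_def)
  fix f :: "int ^ 'a \<Rightarrow> complex" assume f: "f \<in> lp_space p"
  from S obtain C where C: "\<forall>f\<in>lp_space p. lp_norm q (S f) \<le> C * lp_norm p f"
    by (auto simp: bounded_lp_operators_def)
  from T obtain D where D: "\<forall>f\<in>lp_space p. lp_norm q (T f) \<le> D * lp_norm p f"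
    by (auto simp: bounded_lp_operators_def)
  show "S f = T f"
  proof
    fix k
    let ?head = "\<lambda>F n. if n \<in> F then f n else 0" and ?tail = "\<lambda>F n. if n \<in> F then 0 else f n"
    have bound: "cmod (S f k - T f k) \<le> (C + D) * lp_norm p (?tail F)" if F: "finite F" for F
    proof -
      have h: "?head F \<in> lp_space p" by (rule lp_space_finite_support[OF F]) auto
      have t: "?tail F \<in> lp_space p"
        using f unfolding lp_space_def mem_Collect_eq
        by (rule summable_on_comparison_test) auto
      have dec: "f = (\<lambda>n. ?head F n + ?tail F n)" by auto
      have "finitely_supported (?head F)"
        unfolding finitely_supported_def by (rule finite_subset[OF _ F]) auto
      then have hST: "S (?head F) = T (?head F)" by (rule eq)
      have "S f = (\<lambda>n. S (?head F) n + S (?tail F) n)" "T f = (\<lambda>n. T (?head F) n + T (?tail F) n)"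
        using S T h t by (subst dec; simp add: bounded_lp_operators_def del: if_split)+
      then have "S f k - T f k = S (?tail F) k - T (?tail F) k" by (simp add: hST)
      then have "cmod (S f k - T f k) \<le> cmod (S (?tail F) k) + cmod (T (?tail F) k)"
        by (simp add: norm_triangle_ineq4)
      also have "\<dots> \<le> lp_norm q (S (?tail F)) + lp_norm q (T (?tail F))"
        using S T t q by (intro add_mono cmod_le_lp_norm) (auto simp: bounded_lp_operators_def)
      also have "\<dots> \<le> (C + D) * lp_norm p (?tail F)"
        using C D t by (simp add: distrib_right add_mono)
      finally show ?thesis .
    qed
    have "((\<lambda>F. (C + D) * lp_norm p (?tail F)) \<longlongrightarrow> (C + D) * 0) (finite_subsets_at_top UNIV)"
      by (intro tendsto_mult_left lp_norm_tail_tendsto_0 f p)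
    then have "cmod (S f k - T f k) \<le> (C + D) * 0"
      by (rule tendsto_lowerbound)
         (auto simp: eventually_finite_subsets_at_top intro!: exI[of _ "{}"] bound)
    then show "S f k = T f k" by simp
  qed
qed

section \<open>Operators given by matrices with uniformly bounded finite sections\<close>

text \<open>
  The value \<open>undefined\<close> off \<open>lp_space p\<close> makes the operator extensional, as membership in
  \<open>bounded_lp_operators\<close> requires.
\<close>
definition matrix_op :: "real \<Rightarrow> (int ^ 'd \<Rightarrow> int ^ 'd \<Rightarrow> complex) \<Rightarrow> (int ^ 'd \<Rightarrow> complex) \<Rightarrow> int ^ 'd \<Rightarrow> complex" where
  "matrix_op p K f = (if f \<in> lp_space p then (\<lambda>k. \<Sum>\<^sub>\<infinity>n. K k n * f n) else undefined)"

locale bounded_matrix =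
  fixes K :: "int ^ 'd \<Rightarrow> int ^ 'd \<Rightarrow> complex" and p q C :: real
  assumes p: "0 < p" and q: "0 < q" and C: "0 \<le> C"
    and bound: "\<And>F G a. finite F \<Longrightarrow> finite G \<Longrightarrow>
      fin_norm q G (\<lambda>k. \<Sum>n\<in>F. K k n * a n) \<le> C * fin_norm p F a"
begin

text \<open>
  Rotating the phases of the coefficients does not increase their \<open>\<ell>\<^sup>p\<close> norm and turns the
  entry of the image at \<open>k\<close> into the sum of absolute values. This gives absolute
  convergence of the rows, so that the extension has an explicit formula.
\<close>
lemma row_abs_sum_bound:
  assumes "finite F"
  shows "(\<Sum>n\<in>F. cmod (K k n * a n)) \<le> C * fin_norm p F a"
proof -
  define b where "b = (\<lambda>n. cnj (sgn (K k n)) * of_real (cmod (a n)))"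
  have "K k n * b n = of_real (cmod (K k n * a n))" for n
    by (cases "K k n = 0")
       (auto simp: b_def sgn_div_norm scaleR_conv_of_real norm_mult field_simps
          complex_norm_square[symmetric] power2_eq_square)
  then have "(\<Sum>n\<in>F. K k n * b n) = of_real (\<Sum>n\<in>F. cmod (K k n * a n))" by simp
  then have "cmod (\<Sum>n\<in>F. K k n * b n) = (\<Sum>n\<in>F. cmod (K k n * a n))"
    by (simp only: norm_of_real) (simp add: sum_nonneg)
  moreover have "cmod (\<Sum>n\<in>F. K k n * b n) \<le> C * fin_norm p F b"
    using bound[OF assms, of "{k}" b] q by (simp add: fin_norm_singleton)
  moreover have "fin_norm p F b \<le> fin_norm p F a"
    using p by (intro fin_norm_mono) (auto simp: b_def norm_mult norm_sgn)
  ultimately show ?thesis using C by (smt (verit) mult_left_mono)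
qed

lemma row_summable:
  assumes f: "f \<in> lp_space p"
  shows "(\<lambda>n. K k n * f n) summable_on UNIV"
proof (rule abs_summable_summable, rule nonneg_bdd_above_summable_on)
  have "(\<Sum>n\<in>F. cmod (K k n * f n)) \<le> C * lp_norm p f" if "finite F" for F
    using row_abs_sum_bound[OF that] mult_left_mono[OF fin_norm_le_lp_norm[OF f that p] C]
    by (rule order_trans)
  then show "bdd_above (sum (\<lambda>n. cmod (K k n * f n)) ` {F. F \<subseteq> UNIV \<and> finite F})"
    by (intro bdd_aboveI[of _ "C * lp_norm p f"]) auto
qed auto

lemma matrix_op_bound:
  assumes f: "f \<in> lp_space p"
  shows "matrix_op p K f \<in> lp_space q" "lp_norm q (matrix_op p K f) \<le> C * lp_norm p f"
proof -
  have "fin_norm q G (matrix_op p K f) \<le> C * lp_norm p f" if G: "finite G" for G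
  proof -
    have "((\<lambda>F. \<Sum>k\<in>G. cmod (\<Sum>n\<in>F. K k n * f n) powr q) \<longlongrightarrow> (\<Sum>k\<in>G. cmod (matrix_op p K f k) powr q))
        (finite_subsets_at_top UNIV)"
      using f q infsum_tendsto[OF row_summable[OF f]]
      by (intro tendsto_sum tendsto_powr' tendsto_norm tendsto_const) (auto simp: matrix_op_def)
    then have "((\<lambda>F. fin_norm q G (\<lambda>k. \<Sum>n\<in>F. K k n * f n)) \<longlongrightarrow> fin_norm q G (matrix_op p K f))
        (finite_subsets_at_top UNIV)"
      unfolding fin_norm_def using q
      by (intro tendsto_powr' tendsto_const) (auto intro!: always_eventually sum_nonneg)
    then show ?thesis
    proof (rule tendsto_upperbound)
      have "fin_norm q G (\<lambda>k. \<Sum>n\<in>F. K k n * f n) \<le> C * lp_norm p f" if "finite F" for F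
        using bound[OF that G] mult_left_mono[OF fin_norm_le_lp_norm[OF f that p] C]
        by (rule order_trans)
      then show "\<forall>\<^sub>F F in finite_subsets_at_top UNIV. fin_norm q G (\<lambda>k. \<Sum>n\<in>F. K k n * f n) \<le> C * lp_norm p f"
        by (auto simp: eventually_finite_subsets_at_top)
    qed simp
  qed
  from lp_norm_bound_from_finite[OF this q]
  show "matrix_op p K f \<in> lp_space q" "lp_norm q (matrix_op p K f) \<le> C * lp_norm p f"
    by auto
qed

lemma matrix_op_bounded_operator: "matrix_op p K \<in> bounded_lp_operators p q"
proof -
  have "matrix_op p K \<in> lp_space p \<rightarrow>\<^sub>E lp_space q"
    using matrix_op_bound by (auto simp: PiE_def extensional_def matrix_op_def)
  moreover have "matrix_op p K (\<lambda>n. f n + g n) = (\<lambda>n. matrix_op p K f n + matrix_op p K g n)"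
    if "f \<in> lp_space p" "g \<in> lp_space p" for f g
    using that p by (simp add: matrix_op_def lp_space_add distrib_left infsum_add row_summable)
  moreover have "matrix_op p K (\<lambda>n. c * f n) = (\<lambda>n. c * matrix_op p K f n)"
    if "f \<in> lp_space p" for f c
  proof -
    have "(\<Sum>\<^sub>\<infinity>n. K k n * (c * f n)) = c * (\<Sum>\<^sub>\<infinity>n. K k n * f n)" for k
      by (simp add: infsum_cmult_right'[symmetric] mult_ac)
    then show ?thesis using that by (simp add: matrix_op_def lp_space_scale)
  qed
  ultimately show ?thesis
    using matrix_op_bound(2) unfolding bounded_lp_operators_def by blast
qed

end

section \<open>Characters of the torus\<close>

lemma integral_unit_interval_character:
  fixes j :: int
  shows "(LINT x|lborel. indicator {0<..<1} x *\<^sub>R exp (2 * pi * \<i> * (of_int j * complex_of_real x)))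
    = (if j = 0 then 1 else 0)"
proof -
  let ?c = "2 * pi * \<i> * of_int j :: complex"
  have "(LINT x|lborel. indicator {0<..<1} x *\<^sub>R exp (2 * pi * \<i> * (of_int j * complex_of_real x)))
      = (LINT x|lborel. indicator {0..1} x *\<^sub>R exp (?c * complex_of_real x))"
  proof (rule integral_cong_AE)
    have "AE x in lborel. x \<noteq> (0::real) \<and> x \<noteq> 1"
      using AE_lborel_singleton[of "0::real"] AE_lborel_singleton[of "1::real"] by auto
    then show "AE x in lborel. indicator {0<..<1} x *\<^sub>R exp (2 * pi * \<i> * (of_int j * complex_of_real x))
       = indicator {0..1} x *\<^sub>R exp (?c * complex_of_real x)"
      by eventually_elim (auto simp: mult_ac split: split_indicator)
  qed auto
  also have "\<dots> = (if j = 0 then 1 else 0)"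
  proof (cases "j = 0")
    case False
    then have c: "?c \<noteq> 0" by simp
    have "(LINT x|lborel. indicator {0..1} x *\<^sub>R exp (?c * complex_of_real x))
      = exp (?c * complex_of_real 1) / ?c - exp (?c * complex_of_real 0) / ?c"
    proof (rule integral_FTC_atLeastAtMost)
      fix x :: real
      have "((\<lambda>z. exp (?c * z) / ?c) has_field_derivative exp (?c * of_real x)) (at (of_real x))"
        using c by (auto intro!: derivative_eq_intros)
      from has_vector_derivative_real_field[OF this]
      show "((\<lambda>x. exp (?c * complex_of_real x) / ?c) has_vector_derivative exp (?c * complex_of_real x)) (at x within {0..1})"
        by simp
    qed (auto intro!: continuous_intros)
    also have "exp (?c * complex_of_real 1) = 1"
      using exp_eq_1[of "?c"] by (auto simp: mult_ac)
    finally show ?thesis using False by simp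
  qed simp
  finally show ?thesis .
qed

abbreviation torus_measure :: "(real ^ 'd) measure" where
  "torus_measure \<equiv> lebesgue_on (box 0 1)"

definition character :: "int ^ 'd \<Rightarrow> real ^ 'd \<Rightarrow> complex" where
  "character n \<xi> = exp (2 * pi * \<i> * lattice_dot n \<xi>)"

lemma continuous_on_character: "continuous_on S (character n)"
  unfolding character_def lattice_dot_def by (intro continuous_intros)

lemma character_borel_measurable [measurable]: "character n \<in> borel_measurable borel"
  by (rule borel_measurable_continuous_onI[OF continuous_on_character])

lemma character_torus_measurable [measurable]: "character n \<in> borel_measurable torus_measure"
  by (intro measurable_restrict_space1 measurable_completion) simp

lemma cmod_character [simp]: "cmod (character n \<xi>) = 1"
  by (simp add: character_def norm_exp_eq_Re)

lemma cnj_character: "cnj (character n \<xi>) = exp (- (2 * pi * \<i> * lattice_dot n \<xi>))"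
  by (simp add: character_def exp_cnj)

lemma character_diff: "character n \<xi> * cnj (character k \<xi>) = character (n - k) \<xi>"
  by (simp add: cnj_character)
     (simp add: character_def lattice_dot_def left_diff_distrib sum_subtractf right_diff_distrib
        flip: exp_add)

lemma indicator_unit_cube:
  "indicator (box 0 1) \<xi> = (\<Prod>i\<in>UNIV. indicator {0<..<1} (\<xi> $ i) :: real)" for \<xi> :: "real ^ 'd"
proof (cases "\<xi> \<in> box 0 1")
  case True
  then show ?thesis by (auto simp: mem_box_cart)
next
  case False
  then obtain i where "\<xi> $ i \<notin> {0<..<1}" by (auto simp: mem_box_cart)
  then have "(\<Prod>i\<in>UNIV. indicator {0<..<1} (\<xi> $ i) :: real) = 0"
    by (intro prod_zero bexI[of _ i]) auto
  then show ?thesis using False by simp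
qed

text \<open>
  Lebesgue measure is the image of a product measure over the basis vectors, and the integrand is a
  product of functions of one coordinate each. If \<open>n\<close> has a nonzero entry, the corresponding
  one-dimensional factor vanishes.
\<close>
lemma integral_torus_character:
  fixes n :: "int ^ 'd"
  shows "(LINT \<xi>|torus_measure. character n \<xi>) = (if n = 0 then 1 else 0)"
proof -
  interpret product_sigma_finite "\<lambda>_ :: real ^ 'd. lborel :: real measure"
    by unfold_locales
  let ?N = "\<chi> i. real_of_int (n $ i)"
  define h where "h = (\<lambda>(b :: real ^ 'd) x. indicator {0<..<1} x *\<^sub>R exp (2 * pi * \<i> * (?N \<bullet> b) * complex_of_real x))"
  have h: "indicator (box 0 1) \<xi> *\<^sub>R character n \<xi> = (\<Prod>b\<in>Basis. h b (\<xi> \<bullet> b))" for \<xi> :: "real ^ 'd"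
  proof -
    have B: "(\<Prod>b\<in>Basis. h b (\<xi> \<bullet> b)) = (\<Prod>i\<in>UNIV. h (axis i 1) (\<xi> \<bullet> axis i 1))"
      unfolding Basis_vec_def
      by (simp add: UNION_singleton_eq_range) (subst prod.reindex, auto simp: inj_on_def axis_eq_axis)
    show ?thesis
      unfolding B indicator_unit_cube
      by (simp add: h_def inner_axis scaleR_conv_of_real prod.distrib character_def lattice_dot_def
        sum_distrib_left exp_sum mult_ac)
  qed
  have hint: "(LINT x|lborel. h b x) = (if ?N \<bullet> b = 0 then 1 else 0)" if "b \<in> Basis" for b
  proof -
    from that obtain i where "b = axis i 1" by (auto simp: Basis_vec_def)
    then show ?thesis
      using integral_unit_interval_character[of "n $ i"] by (simp add: h_def inner_axis mult_ac)
  qed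
  have hintegrable: "integrable lborel (h b)" for b
  proof -
    have "integrable lborel (\<lambda>x. indicator {0<..<1::real} x *\<^sub>R (1::real))" by simp
    then show ?thesis
      by (rule Bochner_Integration.integrable_bound)
         (auto simp: h_def norm_exp_eq_Re split: split_indicator)
  qed
  have "(LINT \<xi>|torus_measure. character n \<xi>) = (LINT \<xi>|lebesgue. indicator (box 0 1) \<xi> *\<^sub>R character n \<xi>)"
    by (subst integral_restrict_space) auto
  also have "\<dots> = (LINT \<xi>|lborel. indicator (box 0 1) \<xi> *\<^sub>R character n \<xi>)"
    by (rule integral_completion) simp
  also have "\<dots> = (LINT f|(Pi\<^sub>M Basis (\<lambda>_. lborel)). indicator (box 0 1) (\<Sum>b\<in>Basis. f b *\<^sub>R b :: real ^ 'd)
      *\<^sub>R character n (\<Sum>b\<in>Basis. f b *\<^sub>R b))"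
    by (subst lborel_eq, subst integral_distr) auto
  also have "\<dots> = (LINT f|(Pi\<^sub>M Basis (\<lambda>_. lborel)). (\<Prod>b\<in>(Basis :: (real ^ 'd) set). h b (f b)))"
    unfolding h by (intro Bochner_Integration.integral_cong prod.cong refl) (simp add: inner_sum_left_Basis)
  also have "\<dots> = (\<Prod>b\<in>(Basis :: (real ^ 'd) set). LINT x|lborel. h b x)"
    by (rule product_integral_prod) (auto simp: hintegrable)
  also have "\<dots> = (\<Prod>b\<in>(Basis :: (real ^ 'd) set). if ?N \<bullet> b = 0 then 1 else 0)"
    by (intro prod.cong refl hint)
  also have "\<dots> = (if n = 0 then 1 else 0)"
  proof (cases "n = 0")
    case False
    then obtain i where "n $ i \<noteq> 0" by (auto simp: vec_eq_iff)
    then have "?N \<bullet> axis i 1 \<noteq> 0" by (simp add: inner_axis)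
    moreover have "axis i 1 \<in> (Basis :: (real ^ 'd) set)" by simp
    ultimately show ?thesis using False by (subst prod_zero) auto
  qed (auto simp: inner_vec_def)
  finally show ?thesis .
qed

lemma finite_measure_torus: "finite_measure (torus_measure :: (real ^ 'd) measure)"
  by (rule finite_measure_lebesgue_on) simp

lemma integrable_character: "integrable torus_measure (character n)"
proof -
  interpret finite_measure "torus_measure :: (real ^ 'a) measure" by (rule finite_measure_torus)
  show ?thesis by (rule integrable_const_bound[of _ 1]) auto
qed

lemma characters_parseval:
  fixes a :: "int ^ 'd \<Rightarrow> complex"
  assumes "finite F"
  shows "(\<integral>\<^sup>+\<xi>. ennreal ((cmod (\<Sum>n\<in>F. a n * character n \<xi>))\<^sup>2) \<partial>torus_measure)
    = ennreal (\<Sum>n\<in>F. (cmod (a n))\<^sup>2)"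
proof -
  let ?g = "\<lambda>\<xi>. \<Sum>n\<in>F. a n * character n \<xi>"
  have sq: "complex_of_real ((cmod (?g \<xi>))\<^sup>2) = (\<Sum>n\<in>F. \<Sum>k\<in>F. a n * cnj (a k) * character (n - k) \<xi>)" for \<xi>
    unfolding complex_norm_square by (simp add: sum_product flip: character_diff) (simp add: mult_ac)
  have int: "integrable torus_measure (\<lambda>\<xi>. complex_of_real ((cmod (?g \<xi>))\<^sup>2))"
    unfolding sq by (intro Bochner_Integration.integrable_sum integrable_mult_right integrable_character)
  have "complex_of_real (LINT \<xi>|torus_measure. (cmod (?g \<xi>))\<^sup>2)
      = (LINT \<xi>|torus_measure. complex_of_real ((cmod (?g \<xi>))\<^sup>2))"
    by (simp only: integral_complex_of_real)
  also have "\<dots> = (\<Sum>n\<in>F. \<Sum>k\<in>F. a n * cnj (a k) * (if n - k = 0 then 1 else 0))"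
    unfolding sq
    by (simp add: Bochner_Integration.integral_sum integrable_character integral_torus_character)
  also have "\<dots> = (\<Sum>n\<in>F. a n * cnj (a n))"
    using assms by (intro sum.cong refl) (simp add: if_distrib sum.delta cong: if_cong)
  also have "\<dots> = complex_of_real (\<Sum>n\<in>F. (cmod (a n))\<^sup>2)"
    by (simp flip: complex_norm_square)
  finally have "(LINT \<xi>|torus_measure. (cmod (?g \<xi>))\<^sup>2) = (\<Sum>n\<in>F. (cmod (a n))\<^sup>2)"
    unfolding of_real_eq_iff .
  then show ?thesis
    using int unfolding complex_of_real_integrable_eq by (subst nn_integral_eq_integral) auto
qed

interpretation characters: bounded_bessel_system torus_measure character
proof -
  interpret finite_measure "torus_measure :: (real ^ 'a) measure" by (rule finite_measure_torus)
  show "bounded_bessel_system (torus_measure :: (real ^ 'a) measure) character"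
    by unfold_locales (auto simp: characters_parseval)
qed

section \<open>The multiplier operator\<close>

text \<open>
  Integrability of \<open>m\<close> against products of characters is what allows the finite Fourier
  sum to be taken out of the integral.
\<close>
lemma multiplier_op_eq_matrix_sum:
  assumes F: "finite F" "\<And>n. n \<notin> F \<Longrightarrow> f n = 0"
    and int: "\<And>k n. integrable torus_measure (\<lambda>\<xi>. m \<xi> * character n \<xi> * cnj (character k \<xi>))"
  shows "multiplier_op m f k = (\<Sum>n\<in>F. characters.multiplier_matrix m k n * f n)"
proof -
  have fourier: "fourier f \<xi> = (\<Sum>n\<in>F. f n * character n \<xi>)" for \<xi>
  proof -
    have "fourier f \<xi> = infsum (\<lambda>n. f n * character n \<xi>) F"
      unfolding fourier_def character_def using F by (intro infsum_cong_neutral) auto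
    then show ?thesis using F by simp
  qed
  have "multiplier_op m f k = (LINT \<xi>|torus_measure. m \<xi> * fourier f \<xi> * cnj (character k \<xi>))"
    unfolding multiplier_op_def inv_fourier_def set_lebesgue_integral_def cnj_character
    by (subst integral_restrict_space) auto
  also have "\<dots> = (LINT \<xi>|torus_measure. (\<Sum>n\<in>F. f n * (m \<xi> * character n \<xi> * cnj (character k \<xi>))))"
    by (simp add: fourier sum_distrib_left sum_distrib_right mult_ac)
  also have "\<dots> = (\<Sum>n\<in>F. f n * characters.multiplier_matrix m k n)"
    using int by (simp add: Bochner_Integration.integral_sum characters.multiplier_matrix_def)
  finally show ?thesis by (simp add: mult.commute)
qed

lemma weak_L_torus_imp_weak_type:
  assumes "m \<in> weak_L_torus \<alpha>"
  obtains c where "characters.weak_type \<alpha> c m"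
proof -
  from assms obtain c where c: "c > 0"
    "\<And>s. s > 0 \<Longrightarrow> emeasure lebesgue {\<xi> \<in> box 0 1. s \<le> cmod (m \<xi>)} \<le> ennreal (c / s powr \<alpha>)"
    and m: "m \<in> borel_measurable lebesgue"
    by (auto simp: weak_L_torus_def)
  have "m \<in> borel_measurable torus_measure" using m by (rule measurable_restrict_space1)
  moreover have "emeasure torus_measure {\<xi> \<in> space torus_measure. s \<le> cmod (m \<xi>)}
      = emeasure lebesgue {\<xi> \<in> box 0 1. s \<le> cmod (m \<xi>)}" for s
    by (subst emeasure_restrict_space) auto
  ultimately show thesis using c
    by (intro that[of c]) (auto simp: characters.weak_type_def)
qed

theorem theorem2p2:
  fixes m :: "real ^ 'd \<Rightarrow> complex" and \<alpha> p q :: real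
  assumes "\<alpha> > 1"
    and "m \<in> weak_L_torus \<alpha>"
    and "1 < p" and "p \<le> 2" and "2 \<le> q"
    and "1 / p - 1 / q = 1 / \<alpha>"
  shows "(\<exists>C>0. \<forall>f. finitely_supported f \<longrightarrow>
            multiplier_op m f \<in> lp_space q \<and>
            lp_norm q (multiplier_op m f) \<le> C * lp_norm p f) \<and>
         (\<exists>!S. S \<in> bounded_lp_operators p q \<and>
            (\<forall>f. finitely_supported f \<longrightarrow> S f = multiplier_op m f))"
proof -
  obtain c where weak: "characters.weak_type \<alpha> c m"
    using weak_L_torus_imp_weak_type[OF assms(2)] .
  have \<alpha>: "0 < \<alpha>" using assms(1) by simp
  note matrix = characters.multiplier_matrix_bound[OF assms(3,4,5) \<alpha> assms(6) weak]
  obtain C where C: "0 \<le> C" and bound: "\<And>F G a. finite F \<Longrightarrow> finite G \<Longrightarrow>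
      fin_norm q G (\<lambda>k. \<Sum>n\<in>F. characters.multiplier_matrix m k n * a n) \<le> C * fin_norm p F a"
    using matrix(2) by blast
  interpret bounded_matrix "characters.multiplier_matrix m" p q C
    using assms C bound by unfold_locales auto
  let ?S = "matrix_op p (characters.multiplier_matrix m)"
  have S_eq: "?S f = multiplier_op m f" and f_lp: "f \<in> lp_space p" if "finitely_supported f" for f
  proof -
    let ?F = "{n. f n \<noteq> 0}"
    have F: "finite ?F" using that by (simp add: finitely_supported_def)
    show f: "f \<in> lp_space p" by (rule lp_space_finite_support[OF F]) auto
    have "(\<Sum>\<^sub>\<infinity>n. characters.multiplier_matrix m k n * f n) = infsum (\<lambda>n. characters.multiplier_matrix m k n * f n) ?F" for k
      by (rule infsum_cong_neutral) auto
    then show "?S f = multiplier_op m f"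
      using multiplier_op_eq_matrix_sum[OF F _ matrix(1)] f F by (auto simp: matrix_op_def)
  qed
  \<comment> \<open>The bound \<open>C\<close> may vanish; adding 1 makes the constant positive.\<close>
  have "lp_norm q (multiplier_op m f) \<le> (C + 1) * lp_norm p f" if "finitely_supported f" for f
    using matrix_op_bound(2)[OF f_lp[OF that]] lp_norm_nonneg[of p f]
    unfolding S_eq[OF that] distrib_right by linarith
  moreover have "multiplier_op m f \<in> lp_space q" if "finitely_supported f" for f
    using matrix_op_bound(1)[OF f_lp[OF that]] unfolding S_eq[OF that] .
  ultimately have "\<exists>C>0. \<forall>f. finitely_supported f \<longrightarrow>
      multiplier_op m f \<in> lp_space q \<and> lp_norm q (multiplier_op m f) \<le> C * lp_norm p f"
    using C by (intro exI[of _ "C + 1"]) auto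
  moreover have "\<exists>!S. S \<in> bounded_lp_operators p q \<and>
      (\<forall>f. finitely_supported f \<longrightarrow> S f = multiplier_op m f)"
  proof (rule ex1I[of _ ?S])
    show "?S \<in> bounded_lp_operators p q \<and> (\<forall>f. finitely_supported f \<longrightarrow> ?S f = multiplier_op m f)"
      using matrix_op_bounded_operator S_eq by auto
    fix S assume "S \<in> bounded_lp_operators p q \<and> (\<forall>f. finitely_supported f \<longrightarrow> S f = multiplier_op m f)"
    then show "S = ?S"
      using matrix_op_bounded_operator S_eq p q by (intro bounded_lp_operators_eqI[where q = q]) auto
  qed
  ultimately show ?thesis ..
qed

end
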